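(* Let $z_*\in\mathcal Z$ and let $(z^k)_{k\ge0}$ be the sequence generated by the Explicit Fast OGDA algorithm described in the context (with associated sequence $(\bar z^k)_{k\ge0}$). Then, as $k\to+\infty$, $$\|z^k-z^{k-1}\|=o\Big(\frac1k\Big),\quad\langle z^k-z_*,V(z^k)\rangle=o\Big(\frac1k\Big),\quad\|V(z^k)\|=o\Big(\frac1k\Big),\quad\|V(\bar z^k)\|=o\Big(\frac1k\Big).$$
   Context: $\mathcal H$ is a real Hilbert space, $V\colon\mathcal H\to\mathcal H$ is monotone ($\langle x-y,V(x)-V(y)\rangle\ge0$ for all $x,y\in\mathcal H$) and $L$-Lipschitz continuous with $L>0$, and $\mathcal Z:=\{z\in\mathcal H: V(z)=0\}$ is assumed nonempty. Explicit Fast OGDA algorithm: let $\alpha>2$, $z^0,z^1,\bar z^0\in\mathcal H$ and $0<s<\frac{1}{2L}$. For every $k\ge1$ set $$\bar z^k:=z^k+\Big(1-\frac{\alpha}{k+\alpha}\Big)(z^k-z^{k-1})-\frac{\alpha s}{2(k+\alpha)}V(\bar z^{k-1}),$$ $$z^{k+1}:=\bar z^k-\frac s2\Big(1+\frac{k}{k+\alpha}\Big)\big(V(\bar z^k)-V(\bar z^{k-1})\big).$$ *)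

theory Defs
  imports "HOL-Analysis.Analysis" "HOL-Library.Landau_Symbols"
begin

text \<open>
  Monotone in the sense of operator theory; unrelated to the order-theoretic constant
  \<^const>\<open>monotone\<close>.
\<close>

definition monotone_operator :: "('a::real_inner \<Rightarrow> 'a) \<Rightarrow> bool" where
  "monotone_operator V \<longleftrightarrow> (\<forall>x y. 0 \<le> inner (x - y) (V x - V y))"

definition zeros :: "('a \<Rightarrow> 'b::zero) \<Rightarrow> 'a set" where
  "zeros V = {z. V z = 0}"

text \<open>
  The starting points \<open>z 0\<close>, \<open>z 1\<close> and \<open>zb 0\<close> are unconstrained and determine both sequences.
\<close>

definition explicit_fast_OGDA ::
  "('a::real_vector \<Rightarrow> 'a) \<Rightarrow> real \<Rightarrow> real \<Rightarrow> (nat \<Rightarrow> 'a) \<Rightarrow> (nat \<Rightarrow> 'a) \<Rightarrow> bool" where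
  "explicit_fast_OGDA V \<alpha> s z zb \<longleftrightarrow>
    (\<forall>k\<ge>1.
      zb k = z k + (1 - \<alpha> / (real k + \<alpha>)) *\<^sub>R (z k - z (k - 1))
                 - (\<alpha> * s / (2 * (real k + \<alpha>))) *\<^sub>R V (zb (k - 1)) \<and>
      z (k + 1) = zb k - (s / 2 * (1 + real k / (real k + \<alpha>))) *\<^sub>R (V (zb k) - V (zb (k - 1))))"

end

theory Submission
  imports Defs "HOL-Real_Asymp.Real_Asymp"
begin

text \<open>
  The proof is a discrete Lyapunov argument with a one-parameter family of energies. After absorbing
  the step size into \<open>U = s V\<close>, let \<open>x\<^sub>n = z\<^sub>n - z\<^sub>*\<close>, \<open>d\<^sub>n = z\<^sub>n - z\<^sub>n\<^sub>-\<^sub>1\<close>, and let \<open>g\<^sub>n\<close> be the value of \<open>U\<close> at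
  the predicted point that produced \<open>z\<^sub>n\<close>. The iteration is then the recurrence
  \<open>n (d\<^sub>n + g\<^sub>n) = (n + 1) (d\<^sub>n\<^sub>+\<^sub>1 + g\<^sub>n\<^sub>+\<^sub>1) + (\<alpha> - 1) d\<^sub>n\<^sub>+\<^sub>1 + (\<alpha> / 2 - 1) g\<^sub>n\<^sub>+\<^sub>1\<close> (\<open>momentum_recurrence\<close>). It is a
  discretisation of \<open>x'' + (\<alpha> / t) x' + (d/dt) U(x) + (\<alpha> / (2 t)) U(x) = 0\<close>, and the energies
  imitate those of this flow:
  \<open>E\<^sub>\<mu> = \<mu> A + B\<close> with \<open>A\<^sub>n = (\<alpha> - 1) / 2 \<bar>x\<^sub>n\<bar>\<^sup>2 + n \<langle>x\<^sub>n, d\<^sub>n + g\<^sub>n\<rangle>\<close> and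
  \<open>B\<^sub>n = n\<^sup>2 (\<bar>d\<^sub>n + g\<^sub>n\<bar>\<^sup>2 + \<bar>d\<^sub>n\<bar>\<^sup>2) / 4\<close> plus correction terms.

  For \<open>1 < \<mu> < \<alpha> - 1\<close> the energy eventually decreases, and even dissipates a multiple of
  \<open>n S\<^sub>n\<close>, where \<open>S\<^sub>n = \<bar>d\<^sub>n\<bar>\<^sup>2 + \<bar>g\<^sub>n\<bar>\<^sup>2 + \<bar>g\<^sub>n - g\<^sub>n\<^sub>-\<^sub>1\<bar>\<^sup>2\<close> (\<open>energy_dissipation\<close>). In continuous time this uses
  \<open>\<langle>x', (d/dt) U(x)\<rangle> \<ge> 0\<close>. In the discrete setting, monotonicity applies to \<open>U (z\<^sub>n) - U (z\<^sub>n\<^sub>-\<^sub>1)\<close>, not to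
  \<open>g\<^sub>n - g\<^sub>n\<^sub>-\<^sub>1\<close>; the error \<open>e\<^sub>n = g\<^sub>n - U (z\<^sub>n)\<close> satisfies \<open>\<bar>e\<^sub>n\<bar> \<le> s L \<bar>g\<^sub>n - g\<^sub>n\<^sub>-\<^sub>1\<bar>\<close>, and the resulting loss of
  order \<open>n\<^sup>2 \<bar>g\<^sub>n - g\<^sub>n\<^sub>-\<^sub>1\<bar>\<^sup>2\<close> is covered by the squared increment of \<open>n d\<^sub>n\<close> because \<open>s L < 1 / 2\<close>
  (\<open>kinetic_decrease\<close>).

  Since \<open>B\<^sub>n\<close> is comparable with \<open>n\<^sup>2 S\<^sub>n\<close> (\<open>kin_bounds\<close>), an upper bound for the energy is an upper
  bound for \<open>A\<^sub>n\<close>, which forces \<open>x\<^sub>n\<close> to stay bounded (\<open>x_bounded\<close>); then the energy is bounded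
  below and converges, and \<open>\<Sum> n S\<^sub>n\<close> is finite. Comparing two values of \<open>\<mu>\<close>, \<open>B\<^sub>n\<close> itself converges. Because
  \<open>\<Sum> B\<^sub>n / n\<close> is finite, its limit is \<open>0\<close> (\<open>kin_tendsto_0\<close>), that is \<open>n\<^sup>2 S\<^sub>n \<longlonglongrightarrow> 0\<close>. All four rates follow
  from this and the boundedness of \<open>x\<^sub>n\<close>.
\<close>

section \<open>Energy increments for one step\<close>

text \<open>
  With \<open>p = n (D + v)\<close> the recurrence says that \<open>(\<alpha> - 1) x + p\<close> changes only by
  \<open>- (\<alpha> / 2 - 1) v\<close> in one step. This is what makes the quantity below, whose terms are, up to
  a factor, those of \<open>\<bar>(\<alpha> - 1) x + p\<bar>\<^sup>2\<close> that involve \<open>x\<close>, produce no contribution of order \<open>n\<close> in \<open>x\<close>.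
\<close>

lemma anchor_increment:
  fixes x D D' v v' :: "'a::real_inner" and m \<alpha> :: real
  assumes rec: "m *\<^sub>R (D' + v') = (m + 1) *\<^sub>R (D + v) + (\<alpha> - 1) *\<^sub>R D + (\<alpha> / 2 - 1) *\<^sub>R v"
  shows "((\<alpha> - 1) / 2 * (norm x)\<^sup>2 + (m + 1) * inner x (D + v))
       - ((\<alpha> - 1) / 2 * (norm (x - D))\<^sup>2 + m * inner (x - D) (D' + v'))
       = - (\<alpha> / 2 - 1) * inner x v + (m + 1 + (\<alpha> - 1) / 2) * (norm D)\<^sup>2
         + (m + 1 + (\<alpha> / 2 - 1)) * inner D v"
proof -
  have "m * inner (x - D) (D' + v') = inner (x - D) (m *\<^sub>R (D' + v'))" by simp
  also have "\<dots> = inner (x - D) ((m + 1) *\<^sub>R (D + v) + (\<alpha> - 1) *\<^sub>R D + (\<alpha> / 2 - 1) *\<^sub>R v)"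
    unfolding rec ..
  finally show ?thesis
    by (simp add: power2_norm_eq_inner inner_simps inner_commute[of D x] inner_commute[of v x]
        inner_commute[of v D]) (simp add: field_simps)
qed

text \<open>
  Both \<open>p = n (D + v)\<close> and \<open>q = n D\<close> have an explicit increment, so the change of
  \<open>(\<bar>p\<bar>\<^sup>2 + \<bar>q\<bar>\<^sup>2) / 4\<close> is computed exactly. The two negative squares at the end are the squared
  increments; the second one is of order \<open>n\<^sup>2 \<bar>v - v'\<bar>\<^sup>2\<close> and is what pays for replacing the
  operator at the iterates by the operator at the predicted points.
\<close>

lemma kinetic_increment:
  fixes D D' v v' :: "'a::real_inner" and m \<alpha> :: real
  defines "r \<equiv> (\<alpha> - 1) *\<^sub>R D + (\<alpha> / 2) *\<^sub>R v"
  assumes rec: "m *\<^sub>R (D' + v') = (m + 1) *\<^sub>R (D + v) + (\<alpha> - 1) *\<^sub>R D + (\<alpha> / 2 - 1) *\<^sub>R v"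
  shows "(m + 1)\<^sup>2 * ((norm (D + v))\<^sup>2 + (norm D)\<^sup>2) / 4 - m\<^sup>2 * ((norm (D' + v'))\<^sup>2 + (norm D')\<^sup>2) / 4
       = - (m + 1) * ((\<alpha> - 1) * ((norm D)\<^sup>2 + inner D v) + (\<alpha> / 2 - 1) / 2 * (norm v)\<^sup>2)
         - m * (m + 1) / 2 * inner D (v - v')
         - (norm ((\<alpha> - 1) *\<^sub>R D + (\<alpha> / 2 - 1) *\<^sub>R v))\<^sup>2 / 4
         - (norm (r + m *\<^sub>R (v - v')))\<^sup>2 / 4"
proof -
  have D': "m *\<^sub>R D' = (m + 1) *\<^sub>R D + (r + m *\<^sub>R (v - v'))"
    using rec unfolding r_def by (simp add: algebra_simps)
  have 1: "m\<^sup>2 * (norm (D' + v'))\<^sup>2 =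
      (norm ((m + 1) *\<^sub>R (D + v) + (\<alpha> - 1) *\<^sub>R D + (\<alpha> / 2 - 1) *\<^sub>R v))\<^sup>2"
    unfolding rec[symmetric] by (simp add: power_mult_distrib)
  have 2: "m\<^sup>2 * (norm D')\<^sup>2 = (norm ((m + 1) *\<^sub>R D + (r + m *\<^sub>R (v - v'))))\<^sup>2"
    unfolding D'[symmetric] by (simp add: power_mult_distrib)
  show ?thesis
    unfolding distrib_left add_divide_distrib 1 2 r_def
    by (simp add: power2_norm_eq_inner inner_simps inner_commute[of v D]
        inner_commute[of v' D] inner_commute[of v' v])
       (simp add: field_simps power2_eq_square)
qed

text \<open>
  With the factor \<open>n\<^sup>2\<close>, the first two terms are \<open>(\<bar>n (D + v)\<bar>\<^sup>2 + \<bar>n D\<bar>\<^sup>2) / 4\<close>. Here \<open>v\<close> is a value of the operator at a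
  predicted point, \<open>e\<close> its deviation from the value at the iterate, and \<open>\<delta>\<close> the last change of \<open>v\<close>.
  Monotonicity controls \<open>\<langle>D, \<delta>\<rangle>\<close> only up to the change of \<open>e\<close>, and the term with \<open>e\<close> makes that
  error telescope. The last term stores part of the dissipation of order \<open>n\<^sup>2 \<bar>\<delta>\<bar>\<^sup>2\<close> so that it is
  available one step later to absorb the previous \<open>e\<close>. Its weight \<open>1 / 8\<close> lies in the interval from \<open>\<kappa> / 4\<close> to \<open>1 / 4 - \<kappa> / 4\<close>, which is nonempty exactly because \<open>\<kappa> < 1 / 2\<close>.
\<close>

definition kinetic :: "real \<Rightarrow> 'a::real_inner \<Rightarrow> 'a \<Rightarrow> 'a \<Rightarrow> 'a \<Rightarrow> real" where
  "kinetic n D v e \<delta> =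
     n\<^sup>2 * ((norm (D + v))\<^sup>2 / 4 + (norm D)\<^sup>2 / 4 + inner D e / 2 + (norm \<delta>)\<^sup>2 / 8)"

lemma coupling_bound:
  fixes D e \<delta> :: "'a::real_inner"
  assumes "norm e \<le> \<kappa> * norm \<delta>"
  shows "\<bar>inner D e\<bar> \<le> \<kappa> * norm D * norm \<delta>"
  using Cauchy_Schwarz_ineq2[of D e] mult_left_mono[OF assms, of "norm D"] by (simp add: mult_ac)

lemma weighted_young:
  fixes a b c :: real
  assumes "c > 0"
  shows "a * b \<le> c * a\<^sup>2 + b\<^sup>2 / (4 * c)"
proof -
  have "0 \<le> (2 * c * a - b)\<^sup>2 / (4 * c)" using assms by simp
  also have "\<dots> = c * a\<^sup>2 + b\<^sup>2 / (4 * c) - a * b"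
    using assms by (simp add: power2_eq_square field_simps)
  finally show ?thesis by simp
qed

text \<open>
  The correction with \<open>e\<close> spoils only a fraction \<open>2 \<kappa>\<close> of the stored \<open>\<delta>\<close>-term and a little of the \<open>D\<close>-term, and
  the form \<open>\<bar>D + v\<bar>\<^sup>2 + \<bar>D\<bar>\<^sup>2\<close> is definite enough to afford the latter.
\<close>

lemma kinetic_bounds:
  fixes D v e \<delta> :: "'a::real_inner" and n \<kappa> :: real
  assumes "0 \<le> \<kappa>" "\<kappa> < 1 / 2" and e: "norm e \<le> \<kappa> * norm \<delta>"
  shows "(1 / 8 - \<kappa> / 4) / 4 * (n\<^sup>2 * ((norm D)\<^sup>2 + (norm v)\<^sup>2 + (norm \<delta>)\<^sup>2)) \<le> kinetic n D v e \<delta>"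
    and "kinetic n D v e \<delta> \<le> n\<^sup>2 * ((norm D)\<^sup>2 + (norm v)\<^sup>2 + (norm \<delta>)\<^sup>2)"
proof -
  define S where "S = (norm D)\<^sup>2 + (norm v)\<^sup>2 + (norm \<delta>)\<^sup>2"
  define Q where "Q = (norm (D + v))\<^sup>2 / 4 + (norm D)\<^sup>2 / 4 + inner D e / 2 + (norm \<delta>)\<^sup>2 / 8"
  have Q: "Q = (norm D)\<^sup>2 / 2 + inner D v / 2 + (norm v)\<^sup>2 / 4 + inner D e / 2 + (norm \<delta>)\<^sup>2 / 8"
    unfolding Q_def by (simp add: power2_norm_eq_inner inner_simps inner_commute field_simps)
  have "\<bar>inner D e\<bar> \<le> \<kappa> * (norm D * norm \<delta>)"
    using coupling_bound[OF e, of D] by (simp add: mult.assoc)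
  also have "\<dots> \<le> \<kappa> * (((norm D)\<^sup>2 + (norm \<delta>)\<^sup>2) / 2)"
    using assms(1) sum_squares_bound[of "norm D" "norm \<delta>"] by (intro mult_left_mono) auto
  finally have De: "\<bar>inner D e\<bar> / 2 \<le> \<kappa> / 4 * (norm D)\<^sup>2 + \<kappa> / 4 * (norm \<delta>)\<^sup>2"
    by (simp add: field_simps)
  have "\<kappa> * (norm D)\<^sup>2 \<le> 1 / 2 * (norm D)\<^sup>2" "\<kappa> * (norm \<delta>)\<^sup>2 \<le> 1 / 2 * (norm \<delta>)\<^sup>2"
    using assms by (intro mult_right_mono; simp)+
  \<comment> \<open>With \<open>\<kappa> < 1 / 2\<close> there remains the weight \<open>3 / 8\<close> of \<open>\<bar>D\<bar>\<^sup>2\<close>, and \<open>1 / 4\<close> of \<open>\<bar>v\<bar>\<^sup>2\<close>; this splitting of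
    \<open>\<langle>D, v\<rangle> / 2\<close> takes \<open>5 / 16\<close> and \<open>1 / 5\<close> of them.\<close>
  moreover have "norm D * norm v \<le> 5 / 8 * (norm D)\<^sup>2 + 2 / 5 * (norm v)\<^sup>2"
    using weighted_young[of "5/8" "norm D" "norm v"] by simp
  moreover have "norm D * norm v \<le> ((norm D)\<^sup>2 + (norm v)\<^sup>2) / 2"
    using sum_squares_bound[of "norm D" "norm v"] by simp
  moreover have "\<bar>inner D v\<bar> \<le> norm D * norm v"
    by (rule Cauchy_Schwarz_ineq2)
  moreover have "0 \<le> (norm D)\<^sup>2" "0 \<le> (norm v)\<^sup>2" "0 \<le> (norm \<delta>)\<^sup>2"
    "0 \<le> \<kappa> * (norm D)\<^sup>2" "0 \<le> \<kappa> * (norm v)\<^sup>2" "0 \<le> \<kappa> * (norm \<delta>)\<^sup>2" using assms by auto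
  moreover have "(1 / 8 - \<kappa> / 4) / 4 * S = (norm D)\<^sup>2 / 32 + (norm v)\<^sup>2 / 32 + (norm \<delta>)\<^sup>2 / 32
      - \<kappa> * (norm D)\<^sup>2 / 16 - \<kappa> * (norm v)\<^sup>2 / 16 - \<kappa> * (norm \<delta>)\<^sup>2 / 16"
    unfolding S_def by (simp add: field_simps)
  ultimately have "(1 / 8 - \<kappa> / 4) / 4 * S \<le> Q" "Q \<le> S"
    using De unfolding Q S_def by linarith+
  then have "n\<^sup>2 * ((1 / 8 - \<kappa> / 4) / 4 * S) \<le> n\<^sup>2 * Q" "n\<^sup>2 * Q \<le> n\<^sup>2 * S"
    by (intro mult_left_mono; simp)+
  then show "(1 / 8 - \<kappa> / 4) / 4 * (n\<^sup>2 * ((norm D)\<^sup>2 + (norm v)\<^sup>2 + (norm \<delta>)\<^sup>2)) \<le> kinetic n D v e \<delta>"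
    and "kinetic n D v e \<delta> \<le> n\<^sup>2 * ((norm D)\<^sup>2 + (norm v)\<^sup>2 + (norm \<delta>)\<^sup>2)"
    unfolding kinetic_def Q_def S_def by (simp_all add: mult_ac)
qed

text \<open>
  The dangerous term \<open>- m (m + 1) \<langle>D, v - v'\<rangle> / 2\<close> is not small, but by monotonicity
  it is bounded by a telescoping part, a term of lower order and \<open>- m \<langle>q, e'\<rangle> / 2\<close>, where
  \<open>q = r + m (v - v')\<close> is minus the increment of \<open>n D\<close>. Together with \<open>- \<bar>q\<bar>\<^sup>2 / 4\<close> and the change of
  the last term of \<open>kinetic\<close> this leaves a quadratic form in
  \<open>m (v - v')\<close> and \<open>m \<delta>'\<close> that is negative definite with constant \<open>\<eta>\<close>, by \<open>\<kappa> < 1 / 2\<close>. The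
  other cross terms carry one power of \<open>m\<close> less and are split by Young's inequality, at the cost of
  a multiple of \<open>\<bar>D\<bar>\<^sup>2 + \<bar>v\<bar>\<^sup>2\<close> that does not grow with \<open>m\<close>.
\<close>

lemma kinetic_decrease:
  fixes D D' v v' e e' \<delta>' :: "'a::real_inner" and m \<alpha> \<kappa> :: real
  defines "\<eta> \<equiv> 1 / 8 - \<kappa> / 4"
  assumes rec: "m *\<^sub>R (D' + v') = (m + 1) *\<^sub>R (D + v) + (\<alpha> - 1) *\<^sub>R D + (\<alpha> / 2 - 1) *\<^sub>R v"
    and mono: "0 \<le> inner D ((v - e) - (v' - e'))"
    and \<kappa>: "0 \<le> \<kappa>" "\<kappa> < 1 / 2"
    and e: "norm e \<le> \<kappa> * norm (v - v')" and e': "norm e' \<le> \<kappa> * norm \<delta>'"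
    and "\<alpha> > 2" "m \<ge> 1"
  shows "kinetic (m + 1) D v e (v - v') - kinetic m D' v' e' \<delta>'
    \<le> - (m + 1) * ((\<alpha> - 1) * ((norm D)\<^sup>2 + inner D v) + (\<alpha> / 2 - 1) / 2 * (norm v)\<^sup>2)
      + \<alpha>\<^sup>2 / (2 * \<eta>) * ((norm D)\<^sup>2 + (norm v)\<^sup>2)
      - (\<eta> / 4 * m\<^sup>2 - m / 2) * (norm (v - v'))\<^sup>2"
proof -
  define r where "r = (\<alpha> - 1) *\<^sub>R D + (\<alpha> / 2) *\<^sub>R v"
  define \<delta> where "\<delta> = v - v'"
  define q where "q = r + m *\<^sub>R \<delta>"
  have \<eta>: "\<eta> > 0" using \<kappa> by (simp add: \<eta>_def)
  have mD': "m *\<^sub>R D' = (m + 1) *\<^sub>R D + q"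
    using rec unfolding q_def r_def \<delta>_def by (simp add: algebra_simps)

  have "m * (m + 1) / 2 * (inner D e - inner D e') \<le> m * (m + 1) / 2 * inner D \<delta>"
    using mono \<open>m \<ge> 1\<close> unfolding \<delta>_def by (intro mult_left_mono) (auto simp: inner_simps)
  moreover have "m * inner D' e' = (m + 1) * inner D e' + inner q e'"
    using arg_cong[OF mD', of "\<lambda>y. inner y e'"] by (simp add: inner_simps)
  then have "m\<^sup>2 / 2 * inner D' e' = m / 2 * ((m + 1) * inner D e' + inner q e')"
    by (simp add: power2_eq_square)
  ultimately have coupling: "- m * (m + 1) / 2 * inner D \<delta> + (m + 1)\<^sup>2 / 2 * inner D e - m\<^sup>2 / 2 * inner D' e'
      \<le> (m + 1) / 2 * inner D e - m / 2 * inner q e'"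
    by (simp add: algebra_simps power2_eq_square) (simp add: field_simps)

  have r2: "(norm r)\<^sup>2 \<le> 2 * \<alpha>\<^sup>2 * ((norm D)\<^sup>2 + (norm v)\<^sup>2)"
  proof -
    have "norm r \<le> \<alpha> * (norm D + norm v)"
    proof -
      have "norm r \<le> (\<alpha> - 1) * norm D + \<alpha> / 2 * norm v"
        unfolding r_def by (rule norm_triangle_le) (use \<open>\<alpha> > 2\<close> in simp)
      also have "\<dots> \<le> \<alpha> * norm D + \<alpha> * norm v"
        using \<open>\<alpha> > 2\<close> by (intro add_mono mult_right_mono) auto
      finally show ?thesis by (simp add: distrib_left)
    qed
    then have "(norm r)\<^sup>2 \<le> \<alpha>\<^sup>2 * (norm D + norm v)\<^sup>2"
      by (simp add: power_mono flip: power_mult_distrib)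
    also have "\<dots> \<le> \<alpha>\<^sup>2 * (2 * ((norm D)\<^sup>2 + (norm v)\<^sup>2))"
      using sum_squares_bound[of "norm D" "norm v"]
      by (intro mult_left_mono) (auto simp: power2_sum)
    finally show ?thesis by (simp only: mult_ac)
  qed

  \<comment> \<open>The weights of \<open>m\<^sup>2 \<bar>\<delta>\<bar>\<^sup>2\<close> used by \<open>c1\<close> and \<open>c4\<close> add up to \<open>3 / 4 * \<eta>\<close>, which leaves \<open>\<eta> / 4\<close>;
    \<open>c2\<close> uses the available weight \<open>\<eta>\<close> of \<open>m\<^sup>2 \<bar>\<delta>'\<bar>\<^sup>2\<close> entirely.\<close>
  have "(norm q)\<^sup>2 = (norm r)\<^sup>2 + 2 * m * inner r \<delta> + m\<^sup>2 * (norm \<delta>)\<^sup>2"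
    unfolding q_def power2_norm_eq_inner
    by (simp add: inner_simps inner_commute power2_eq_square algebra_simps)
  then have q2: "- (norm q)\<^sup>2 / 4 \<le> - m / 2 * inner r \<delta> - m\<^sup>2 / 4 * (norm \<delta>)\<^sup>2"
    by simp
  have "- inner r \<delta> * m \<le> (m * norm \<delta>) * norm r"
    using Cauchy_Schwarz_ineq2[of r \<delta>] mult_right_mono[of "- inner r \<delta>" "norm r * norm \<delta>" m] \<open>m \<ge> 1\<close>
    by (simp add: mult_ac)
  also have "\<dots> \<le> \<eta> * (m * norm \<delta>)\<^sup>2 + (norm r)\<^sup>2 / (4 * \<eta>)"
    by (rule weighted_young[OF \<eta>])
  finally have c1: "- m / 2 * inner r \<delta> \<le> \<eta> / 2 * m\<^sup>2 * (norm \<delta>)\<^sup>2 + (norm r)\<^sup>2 / (8 * \<eta>)"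
    by (simp add: power_mult_distrib algebra_simps)
  have e'r: "- inner r e' \<le> (norm \<delta>' / 2) * norm r"
  proof -
    have "- inner r e' \<le> norm r * (\<kappa> * norm \<delta>')"
      using coupling_bound[OF e', of r] by (simp add: mult_ac)
    also have "\<dots> \<le> norm r * (1/2 * norm \<delta>')"
      using \<kappa> by (intro mult_left_mono mult_right_mono) auto
    finally show ?thesis by (simp add: mult_ac)
  qed
  have "- inner r e' * m \<le> (m * norm \<delta>') * (norm r / 2)"
    using mult_right_mono[OF e'r, of m] \<open>m \<ge> 1\<close> by (simp add: mult_ac)
  also have "\<dots> \<le> (2 * \<eta>) * (m * norm \<delta>')\<^sup>2 + (norm r / 2)\<^sup>2 / (4 * (2 * \<eta>))"
    using \<eta> by (intro weighted_young) auto
  finally have c2: "- m / 2 * inner r e' \<le> \<eta> * m\<^sup>2 * (norm \<delta>')\<^sup>2 + (norm r)\<^sup>2 / (64 * \<eta>)"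
    by (simp add: power_mult_distrib algebra_simps power_divide)
  have "- inner \<delta> e' \<le> \<kappa> * (norm \<delta> * norm \<delta>')"
    using coupling_bound[OF e', of \<delta>] by (simp add: mult_ac)
  also have "\<dots> \<le> \<kappa> * (((norm \<delta>)\<^sup>2 + (norm \<delta>')\<^sup>2) / 2)"
    using \<kappa> sum_squares_bound[of "norm \<delta>" "norm \<delta>'"] by (intro mult_left_mono) auto
  finally have "m\<^sup>2 / 2 * (- inner \<delta> e') \<le> m\<^sup>2 / 2 * (\<kappa> * (((norm \<delta>)\<^sup>2 + (norm \<delta>')\<^sup>2) / 2))"
    by (intro mult_left_mono) auto
  then have c3: "- m\<^sup>2 / 2 * inner \<delta> e' \<le> \<kappa> / 4 * m\<^sup>2 * (norm \<delta>)\<^sup>2 + \<kappa> / 4 * m\<^sup>2 * (norm \<delta>')\<^sup>2"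
    by (simp add: algebra_simps)
  have q_e': "- m / 2 * inner q e' = - m / 2 * inner r e' - m\<^sup>2 / 2 * inner \<delta> e'"
    unfolding q_def by (simp add: inner_simps power2_eq_square algebra_simps)
  have "inner D e \<le> norm D * (\<kappa> * norm \<delta>)"
    using coupling_bound[OF e, of D] by (simp add: mult_ac \<delta>_def)
  also have "\<dots> \<le> norm D * (1/2 * norm \<delta>)"
    using \<kappa> by (intro mult_left_mono mult_right_mono) auto
  finally have "(m + 1) / 2 * inner D e \<le> (m + 1) / 2 * (norm D * (1/2 * norm \<delta>))"
    using \<open>m \<ge> 1\<close> by (intro mult_left_mono) auto
  also have "\<dots> \<le> m * (norm D * (1/2 * norm \<delta>))"
    using \<open>m \<ge> 1\<close> by (intro mult_right_mono) auto
  also have "\<dots> = (m * norm \<delta>) * (norm D / 2)" by simp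
  also have "\<dots> \<le> \<eta> / 4 * (m * norm \<delta>)\<^sup>2 + (norm D / 2)\<^sup>2 / (4 * (\<eta> / 4))"
    using \<eta> by (intro weighted_young) auto
  finally have c4: "(m + 1) / 2 * inner D e \<le> \<eta> / 4 * m\<^sup>2 * (norm \<delta>)\<^sup>2 + (norm D)\<^sup>2 / (4 * \<eta>)"
    by (simp add: power_mult_distrib algebra_simps power_divide)
  have c5: "(2 * m + 1) / 8 * (norm \<delta>)\<^sup>2 \<le> m / 2 * (norm \<delta>)\<^sup>2"
    using \<open>m \<ge> 1\<close> by (intro mult_right_mono) auto
  have c6: "(norm r)\<^sup>2 / (8 * \<eta>) + (norm r)\<^sup>2 / (64 * \<eta>) + (norm D)\<^sup>2 / (4 * \<eta>)
      \<le> \<alpha>\<^sup>2 / (2 * \<eta>) * ((norm D)\<^sup>2 + (norm v)\<^sup>2)"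
  proof -
    have "4 * (norm D)\<^sup>2 \<le> \<alpha>\<^sup>2 * (norm D)\<^sup>2"
      using \<open>\<alpha> > 2\<close> power_mono[of 2 \<alpha> 2] by (intro mult_right_mono) auto
    moreover have "0 \<le> \<alpha>\<^sup>2 * (norm v)\<^sup>2" "0 \<le> (norm D)\<^sup>2" by simp_all
    ultimately have "9 * (norm r)\<^sup>2 + 16 * (norm D)\<^sup>2 \<le> 32 * (\<alpha>\<^sup>2 * ((norm D)\<^sup>2 + (norm v)\<^sup>2))"
      using r2 unfolding distrib_left by linarith
    from divide_right_mono[OF this, of "64 * \<eta>"] show ?thesis
      using \<eta> by (simp add: add_divide_distrib)
  qed

  have "kinetic (m + 1) D v e (v - v') - kinetic m D' v' e' \<delta>'
      = ((m + 1)\<^sup>2 * ((norm (D + v))\<^sup>2 + (norm D)\<^sup>2) / 4 - m\<^sup>2 * ((norm (D' + v'))\<^sup>2 + (norm D')\<^sup>2) / 4)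
        + (m + 1)\<^sup>2 / 2 * inner D e - m\<^sup>2 / 2 * inner D' e'
        + (m\<^sup>2 * (norm \<delta>)\<^sup>2 - m\<^sup>2 * (norm \<delta>')\<^sup>2) / 8 + (2 * m + 1) / 8 * (norm \<delta>)\<^sup>2"
    unfolding kinetic_def \<delta>_def[symmetric] by (simp add: field_simps power2_eq_square)
  also have "\<dots> \<le> - (m + 1) * ((\<alpha> - 1) * ((norm D)\<^sup>2 + inner D v) + (\<alpha> / 2 - 1) / 2 * (norm v)\<^sup>2)
      + ((m + 1) / 2 * inner D e - m / 2 * inner q e') - (norm q)\<^sup>2 / 4
      + (m\<^sup>2 * (norm \<delta>)\<^sup>2 - m\<^sup>2 * (norm \<delta>')\<^sup>2) / 8 + (2 * m + 1) / 8 * (norm \<delta>)\<^sup>2"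
    unfolding kinetic_increment[OF rec]
    using coupling zero_le_power2[of "norm ((\<alpha> - 1) *\<^sub>R D + (\<alpha> / 2 - 1) *\<^sub>R v)"]
    unfolding q_def r_def \<delta>_def[symmetric] by linarith
  also have "\<dots> \<le> - (m + 1) * ((\<alpha> - 1) * ((norm D)\<^sup>2 + inner D v) + (\<alpha> / 2 - 1) / 2 * (norm v)\<^sup>2)
      + \<alpha>\<^sup>2 / (2 * \<eta>) * ((norm D)\<^sup>2 + (norm v)\<^sup>2) - (\<eta> / 4 * m\<^sup>2 - m / 2) * (norm \<delta>)\<^sup>2"
  proof -
    have "\<eta> * m\<^sup>2 * (norm \<delta>)\<^sup>2 = m\<^sup>2 * (norm \<delta>)\<^sup>2 / 8 - \<kappa> / 4 * m\<^sup>2 * (norm \<delta>)\<^sup>2"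
      "\<eta> * m\<^sup>2 * (norm \<delta>')\<^sup>2 = m\<^sup>2 * (norm \<delta>')\<^sup>2 / 8 - \<kappa> / 4 * m\<^sup>2 * (norm \<delta>')\<^sup>2"
      unfolding \<eta>_def by (simp_all add: algebra_simps)
    moreover have "(\<eta> / 4 * m\<^sup>2 - m / 2) * (norm \<delta>)\<^sup>2 = \<eta> * m\<^sup>2 * (norm \<delta>)\<^sup>2 / 4 - m / 2 * (norm \<delta>)\<^sup>2"
      by (simp add: algebra_simps)
    moreover have "(m\<^sup>2 * (norm \<delta>)\<^sup>2 - m\<^sup>2 * (norm \<delta>')\<^sup>2) / 8 = m\<^sup>2 * (norm \<delta>)\<^sup>2 / 8 - m\<^sup>2 * (norm \<delta>')\<^sup>2 / 8"
      by (simp add: diff_divide_distrib)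
    ultimately show ?thesis
      using q2 c1 c2 c3 c4 c5 c6 q_e' by linarith
  qed
  finally show ?thesis unfolding \<delta>_def .
qed

text \<open>
  The form in \<open>(D, v)\<close> that is dissipated at rate \<open>n\<close> has discriminant
  \<open>(\<alpha> - 1 - \<mu>) (1 - \<mu>)\<close>, which gives the range \<open>1 < \<mu> < \<alpha> - 1\<close>. This range is nonempty precisely when
  \<open>\<alpha> > 2\<close>.
\<close>

lemma cross_form_dissipative:
  fixes D v :: "'a::real_inner" and \<alpha> \<mu> :: real
  defines "\<rho> \<equiv> min ((\<alpha> - 1 - \<mu>) / 2) ((\<mu> - 1) / 6)"
  assumes "1 < \<mu>" "\<mu> < \<alpha> - 1"
  shows "\<rho> * ((norm D)\<^sup>2 + (norm v)\<^sup>2)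
    \<le> (\<alpha> - 1 - \<mu>) * ((norm D)\<^sup>2 + inner D v) + (\<alpha> / 2 - 1) / 2 * (norm v)\<^sup>2"
proof -
  \<comment> \<open>Completing the square: in terms of \<open>w\<close> and \<open>v\<close> the form is diagonal, with weights
    \<open>\<alpha> - 1 - \<mu>\<close> and \<open>(\<mu> - 1) / 4\<close>.\<close>
  define w where "w = D + (1/2) *\<^sub>R v"
  have D: "D = w - (1/2) *\<^sub>R v" by (simp add: w_def)
  have "(norm D)\<^sup>2 + (norm (w + (1/2) *\<^sub>R v))\<^sup>2 = 2 * (norm w)\<^sup>2 + (norm v)\<^sup>2 / 2"
    unfolding D power2_norm_eq_inner by (simp add: inner_simps inner_commute)
  then have D2: "(norm D)\<^sup>2 \<le> 2 * (norm w)\<^sup>2 + (norm v)\<^sup>2 / 2"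
    using zero_le_power2[of "norm (w + (1/2) *\<^sub>R v)"] by linarith
  have "\<rho> \<ge> 0" using assms by simp
  then have "\<rho> * ((norm D)\<^sup>2 + (norm v)\<^sup>2) \<le> \<rho> * (2 * (norm w)\<^sup>2 + 3/2 * (norm v)\<^sup>2)"
    using D2 by (intro mult_left_mono) auto
  also have "\<dots> = 2 * \<rho> * (norm w)\<^sup>2 + 3/2 * \<rho> * (norm v)\<^sup>2"
    by (simp add: algebra_simps)
  also have "\<dots> \<le> (\<alpha> - 1 - \<mu>) * (norm w)\<^sup>2 + (\<mu> - 1) / 4 * (norm v)\<^sup>2"
    by (intro add_mono mult_right_mono) (auto simp: \<rho>_def min_def)
  also have "\<dots> = (\<alpha> - 1 - \<mu>) * ((norm D)\<^sup>2 + inner D v) + (\<alpha> / 2 - 1) / 2 * (norm v)\<^sup>2"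
    unfolding D power2_norm_eq_inner by (simp add: inner_simps inner_commute field_simps)
  finally show ?thesis .
qed

section \<open>Real sequences\<close>

lemma convergent_if_eventually_decseq_bounded_below:
  fixes f :: "nat \<Rightarrow> real"
  assumes dec: "\<forall>\<^sub>F n in sequentially. f (Suc n) \<le> f n"
    and low: "\<forall>\<^sub>F n in sequentially. c \<le> f n"
  shows "convergent f"
proof -
  from eventually_conj[OF dec low] obtain N where N: "\<And>n. n \<ge> N \<Longrightarrow> f (Suc n) \<le> f n \<and> c \<le> f n"
    by (auto simp: eventually_sequentially)
  have "decseq (\<lambda>n. f (n + N))"
    using N by (intro decseq_SucI) auto
  then obtain l where "(\<lambda>n. f (n + N)) \<longlonglongrightarrow> l"
    by (rule decseq_convergent[where B = c]) (use N in auto)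
  then show ?thesis
    using LIMSEQ_offset convergentI by blast
qed

lemma summable_if_eventually_telescoping:
  fixes f a :: "nat \<Rightarrow> real"
  assumes nonneg: "\<And>n. 0 \<le> a n" and f: "convergent f"
    and le: "\<forall>\<^sub>F n in sequentially. a n \<le> f n - f (Suc n)"
  shows "summable a"
proof -
  from f obtain l where "f \<longlonglongrightarrow> l" by (auto simp: convergent_def)
  then have "summable (\<lambda>n. f n - f (Suc n))"
    using telescope_summable'[of f l] by simp
  then show ?thesis
    by (rule summable_comparison_test_ev[rotated]) (use le nonneg in \<open>auto elim: eventually_mono\<close>)
qed

lemma limit_zero_if_harmonic_summable:
  fixes f :: "nat \<Rightarrow> real"
  assumes "f \<longlonglongrightarrow> l" "\<And>n. 0 \<le> f n" "summable (\<lambda>n. f n / real n)"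
  shows "l = 0"
proof (rule ccontr)
  assume "l \<noteq> 0"
  with assms have "l > 0"
    using LIMSEQ_le_const[OF assms(1), of 0] by force
  then have "\<forall>\<^sub>F n in sequentially. l / 2 < f n"
    using assms(1) by (intro order_tendstoD) auto
  then have "\<forall>\<^sub>F n in sequentially. norm (l / 2 * (1 / real n)) \<le> f n / real n"
  proof eventually_elim
    case (elim n)
    then have "l / 2 / real n \<le> f n / real n" by (intro divide_right_mono) auto
    then show ?case using \<open>l > 0\<close> by simp
  qed
  from summable_comparison_test_ev[OF this assms(3)] have "summable (\<lambda>n. l / 2 * (1 / real n))" .
  then have "summable (\<lambda>n. 1 / real n)"
    using \<open>l > 0\<close> by (subst (asm) summable_cmult_iff) auto
  then show False
    using not_summable_harmonic[where 'a=real] by (simp add: inverse_eq_divide)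
qed

text \<open>
  If \<open>C \<le> c M\<close>, the right-hand side is at most \<open>(Suc n + c) M\<close> whenever \<open>h n \<le> M\<close>, so the bound \<open>M\<close>
  is inherited.
\<close>

lemma damped_recursion_bounded:
  fixes h :: "nat \<Rightarrow> real"
  assumes "c > 0"
    and rec: "\<forall>\<^sub>F n in sequentially. (real (Suc n) + c) * h (Suc n) \<le> real (Suc n) * h n + C"
  shows "\<exists>M. \<forall>\<^sub>F n in sequentially. h n \<le> M"
proof -
  from rec obtain N where N: "\<And>n. n \<ge> N \<Longrightarrow> (real (Suc n) + c) * h (Suc n) \<le> real (Suc n) * h n + C"
    by (auto simp: eventually_sequentially)
  define M where "M = max (h N) (C / c)"
  have "h n \<le> M" if "n \<ge> N" for n
    using that
  proof (induction rule: dec_induct)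
    case base
    show ?case by (simp add: M_def)
  next
    case (step n)
    have "C / c \<le> M" by (simp add: M_def)
    then have "C \<le> c * M" using \<open>c > 0\<close> by (simp add: field_simps)
    moreover have "real (Suc n) * h n \<le> real (Suc n) * M"
      using step.IH by (intro mult_left_mono) auto
    ultimately have "(real (Suc n) + c) * h (Suc n) \<le> (real (Suc n) + c) * M"
      using N[OF \<open>N \<le> n\<close>] by (simp add: algebra_simps)
    then show ?case using \<open>c > 0\<close> by (simp add: mult_le_cancel_left_pos)
  qed
  then show ?thesis by (auto simp: eventually_sequentially)
qed

section \<open>The iteration\<close>

text \<open>
  The step size is absorbed into the operator \<open>U\<close>, whose Lipschitz constant is then \<open>\<kappa> = s L < 1 / 2\<close>.
\<close>

locale fast_ogda_iteration =
  fixes U :: "'a::real_inner \<Rightarrow> 'a" and \<alpha> \<kappa> :: real and z zb :: "nat \<Rightarrow> 'a" and zs :: 'a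
  assumes U_mono: "\<And>x y. 0 \<le> inner (x - y) (U x - U y)"
    and U_lipschitz: "\<And>x y. norm (U x - U y) \<le> \<kappa> * norm (x - y)"
    and \<kappa>_nonneg: "0 \<le> \<kappa>" and \<kappa>_less: "\<kappa> < 1 / 2"
    and \<alpha>_gt: "\<alpha> > 2"
    and iteration: "explicit_fast_OGDA U \<alpha> 1 z zb"
    and U_zs: "U zs = 0"
begin

text \<open>
  The index of \<open>g\<close> is shifted: \<open>g n\<close> is the operator at the predicted point that produced \<open>z n\<close>,
  and plays the part of \<open>U (z n)\<close>, from which it differs by \<open>e n\<close>. At \<open>n = 0\<close> the truncated
  subtraction yields junk values; \<open>e n\<close> can be bounded by \<open>dg n\<close> only from \<open>n = 2\<close> on, since \<open>z 1\<close> is a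
  free starting point.
\<close>

definition x :: "nat \<Rightarrow> 'a" where "x n = z n - zs"
definition d :: "nat \<Rightarrow> 'a" where "d n = z n - z (n - 1)"
definition g :: "nat \<Rightarrow> 'a" where "g n = U (zb (n - 1))"
definition dg :: "nat \<Rightarrow> 'a" where "dg n = g n - g (n - 1)"
definition e :: "nat \<Rightarrow> 'a" where "e n = g n - U (z n)"

lemma step:
  assumes "n \<ge> 1"
  shows "zb n = z n + (1 - \<alpha> / (real n + \<alpha>)) *\<^sub>R d n - (\<alpha> / (2 * (real n + \<alpha>))) *\<^sub>R g n"
    and "z (Suc n) = zb n - (1 / 2 * (1 + real n / (real n + \<alpha>))) *\<^sub>R dg (Suc n)"
  using iteration assms unfolding explicit_fast_OGDA_def by (simp_all add: d_def g_def dg_def)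

text \<open>
  Multiplying the update by \<open>n + \<alpha>\<close> removes all fractions and shows the vector \<open>n (d n + g n)\<close>
  as the natural momentum of the iteration.
\<close>

lemma momentum_recurrence:
  assumes "n \<ge> 1"
  shows "real n *\<^sub>R (d n + g n) = (real n + 1) *\<^sub>R (d (Suc n) + g (Suc n))
    + (\<alpha> - 1) *\<^sub>R d (Suc n) + (\<alpha> / 2 - 1) *\<^sub>R g (Suc n)"
proof -
  define t where "t = real n + \<alpha>"
  have t: "t > 0" using \<alpha>_gt by (simp add: t_def)
  have "d (Suc n) = (1 - \<alpha> / t) *\<^sub>R d n - (\<alpha> / (2 * t)) *\<^sub>R g n
      - (1 / 2 * (1 + real n / t)) *\<^sub>R (g (Suc n) - g n)"
    using step[OF assms] by (simp add: d_def t_def dg_def)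
  then have "t *\<^sub>R d (Suc n) = t *\<^sub>R ((1 - \<alpha> / t) *\<^sub>R d n - (\<alpha> / (2 * t)) *\<^sub>R g n
      - (1 / 2 * (1 + real n / t)) *\<^sub>R (g (Suc n) - g n))" by simp
  also have "\<dots> = (t - \<alpha>) *\<^sub>R d n - (\<alpha> / 2) *\<^sub>R g n - ((t + real n) / 2) *\<^sub>R (g (Suc n) - g n)"
  proof -
    have "t * (1 - \<alpha> / t) = t - \<alpha>" "t * (\<alpha> / (2 * t)) = \<alpha> / 2"
      "t * (1 / 2 * (1 + real n / t)) = (t + real n) / 2"
      using t by (simp_all add: field_simps)
    then show ?thesis by (simp only: scaleR_diff_right scaleR_scaleR)
  qed
  finally have eq: "t *\<^sub>R d (Suc n) = real n *\<^sub>R d n - (\<alpha> / 2) *\<^sub>R g n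
      - (real n + \<alpha> / 2) *\<^sub>R (g (Suc n) - g n)"
    by (simp add: t_def add_divide_distrib)
  have "(real n + 1) *\<^sub>R (d (Suc n) + g (Suc n)) + (\<alpha> - 1) *\<^sub>R d (Suc n) + (\<alpha> / 2 - 1) *\<^sub>R g (Suc n)
     = t *\<^sub>R d (Suc n) + (real n + \<alpha> / 2) *\<^sub>R g (Suc n)"
    unfolding t_def by (simp add: algebra_simps)
  also have "\<dots> = real n *\<^sub>R (d n + g n)"
    unfolding eq by (simp add: algebra_simps)
  finally show ?thesis by simp
qed

lemma correction_step_le:
  assumes "n \<ge> 1"
  shows "norm (z (Suc n) - zb n) \<le> norm (dg (Suc n))"
proof -
  have "0 \<le> real n / (real n + \<alpha>)" "real n / (real n + \<alpha>) \<le> 1"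
    using \<alpha>_gt by (simp_all add: divide_le_eq)
  then have "\<bar>1 / 2 * (1 + real n / (real n + \<alpha>))\<bar> \<le> 1" by simp
  then have "\<bar>1 / 2 * (1 + real n / (real n + \<alpha>))\<bar> * norm (dg (Suc n)) \<le> norm (dg (Suc n))"
    by (rule mult_left_le_one_le[OF norm_ge_zero abs_ge_zero])
  then show ?thesis using step(2)[OF assms] by simp
qed

text \<open>
  The correction step moves the predicted point by at most \<open>\<bar>dg n\<bar>\<close>, so the Lipschitz bound makes the
  prediction error a proper fraction of the last change of \<open>g\<close>.
\<close>

lemma e_le:
  assumes "n \<ge> 2"
  shows "norm (e n) \<le> \<kappa> * norm (dg n)"
proof -
  obtain m where m: "n = Suc m" "m \<ge> 1" using assms by (cases n) auto
  have "norm (e n) \<le> \<kappa> * norm (zb m - z n)"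
    using U_lipschitz[of "zb m" "z n"] by (simp add: e_def g_def m)
  also have "\<dots> \<le> \<kappa> * norm (dg n)"
    using correction_step_le[OF m(2)] \<kappa>_nonneg unfolding m(1)
    by (intro mult_left_mono) (auto simp: norm_minus_commute)
  finally show ?thesis .
qed

lemma x_g_ge:
  assumes "n \<ge> 2"
  shows "- (norm (dg n) * norm (g n)) \<le> inner (x n) (g n)"
proof -
  obtain m where m: "n = Suc m" "m \<ge> 1" using assms by (cases n) auto
  have "0 \<le> inner (zb m - zs) (g n)"
    using U_mono[of "zb m" zs] U_zs by (simp add: g_def m)
  moreover have "inner (x n) (g n) = inner (zb m - zs) (g n) + inner (z n - zb m) (g n)"
    by (simp add: x_def inner_simps)
  moreover have "\<bar>inner (z n - zb m) (g n)\<bar> \<le> norm (z n - zb m) * norm (g n)"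
    by (rule Cauchy_Schwarz_ineq2)
  moreover have "norm (z n - zb m) * norm (g n) \<le> norm (dg n) * norm (g n)"
    using correction_step_le[OF m(2)] unfolding m(1) by (intro mult_right_mono) auto
  ultimately show ?thesis by linarith
qed

section \<open>The energy along the iteration\<close>

definition size_sq :: "nat \<Rightarrow> real" where
  "size_sq n = (norm (d n))\<^sup>2 + (norm (g n))\<^sup>2 + (norm (dg n))\<^sup>2"
definition anchor :: "nat \<Rightarrow> real" where
  "anchor n = (\<alpha> - 1) / 2 * (norm (x n))\<^sup>2 + real n * inner (x n) (d n + g n)"
definition kin :: "nat \<Rightarrow> real" where
  "kin n = kinetic (real n) (d n) (g n) (e n) (dg n)"

text \<open>
  The energy is affine in the parameter \<open>\<mu>\<close>, so its convergence for two values of \<open>\<mu>\<close> gives the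
  convergence of \<open>anchor\<close> and \<open>kin\<close> separately.
\<close>

definition energy :: "real \<Rightarrow> nat \<Rightarrow> real" where
  "energy \<mu> n = \<mu> * anchor n + kin n"

definition \<beta> :: real where "\<beta> = (1 / 8 - \<kappa> / 4) / 4"

lemma \<beta>_pos: "\<beta> > 0" using \<kappa>_less by (simp add: \<beta>_def)

lemma size_sq_nonneg: "0 \<le> size_sq n" by (simp add: size_sq_def)

lemma kin_bounds:
  assumes "n \<ge> 2"
  shows "\<beta> * ((real n)\<^sup>2 * size_sq n) \<le> kin n" and "kin n \<le> (real n)\<^sup>2 * size_sq n"
  using kinetic_bounds[OF \<kappa>_nonneg \<kappa>_less e_le[OF assms], of "real n" "d n" "g n"]
  unfolding kin_def size_sq_def \<beta>_def .

text \<open>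
  At order \<open>n\<close> the increments of \<open>\<mu> * anchor\<close> and \<open>kin\<close> combine to the form of
  \<open>cross_form_dissipative\<close>. The contributions of order \<open>1\<close> are collected in the constant \<open>K\<close>; they
  include the possibly negative part of \<open>\<langle>x, g\<rangle>\<close>, which is bounded by \<open>\<bar>dg\<bar> \<bar>g\<bar>\<close>.
\<close>

lemma energy_step:
  assumes \<mu>: "1 < \<mu>" "\<mu> < \<alpha> - 1" and m: "m \<ge> 2"
  defines "\<rho> \<equiv> min ((\<alpha> - 1 - \<mu>) / 2) ((\<mu> - 1) / 6)" and "K \<equiv> \<alpha>\<^sup>2 / (8 * \<beta>) + \<mu> * \<alpha>"
  shows "energy \<mu> (Suc m) - energy \<mu> m
    \<le> - (\<rho> * (real m + 1) - K) * ((norm (d (Suc m)))\<^sup>2 + (norm (g (Suc m)))\<^sup>2)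
      - (\<beta> * (real m)\<^sup>2 - real m / 2 - K) * (norm (dg (Suc m)))\<^sup>2"
proof -
  define D v \<delta> where "D = d (Suc m)" and "v = g (Suc m)" and "\<delta> = dg (Suc m)"
  define N where "N = (norm D)\<^sup>2 + (norm v)\<^sup>2"
  have \<delta>: "v - g m = \<delta>" by (simp add: v_def \<delta>_def dg_def)
  have b: "0 \<le> \<alpha> / 2 - 1" using \<alpha>_gt by simp
  have rec: "real m *\<^sub>R (d m + g m) = (real m + 1) *\<^sub>R (D + v) + (\<alpha> - 1) *\<^sub>R D + (\<alpha> / 2 - 1) *\<^sub>R v"
    unfolding D_def v_def using m by (intro momentum_recurrence) auto
  have mono: "0 \<le> inner D ((v - e (Suc m)) - (g m - e m))"
    using U_mono[of "z (Suc m)" "z m"] by (simp add: D_def v_def d_def e_def)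
  have kin_step: "kin (Suc m) - kin m \<le> - (real m + 1) * ((\<alpha> - 1) * ((norm D)\<^sup>2 + inner D v) + (\<alpha> / 2 - 1) / 2 * (norm v)\<^sup>2)
      + \<alpha>\<^sup>2 / (8 * \<beta>) * N - (\<beta> * (real m)\<^sup>2 - real m / 2) * (norm \<delta>)\<^sup>2"
  proof -
    have "1 / 8 - \<kappa> / 4 = 4 * \<beta>" by (simp add: \<beta>_def)
    moreover have "norm (e (Suc m)) \<le> \<kappa> * norm (v - g m)"
      using e_le[of "Suc m"] m by (simp add: \<delta> \<delta>_def)
    ultimately show ?thesis
      using kinetic_decrease[OF rec mono \<kappa>_nonneg \<kappa>_less _ e_le[OF m] \<alpha>_gt] m
      unfolding kin_def \<delta> N_def by (simp add: D_def v_def \<delta>_def add.commute)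
  qed
  have anchor_step: "anchor (Suc m) - anchor m
      = - (\<alpha> / 2 - 1) * inner (x (Suc m)) v + (real m + 1 + (\<alpha> - 1) / 2) * (norm D)\<^sup>2
         + (real m + 1 + (\<alpha> / 2 - 1)) * inner D v"
    using anchor_increment[OF rec, of "x (Suc m)"]
    unfolding anchor_def by (simp add: D_def v_def x_def d_def add.commute)
  have "- (\<alpha> / 2 - 1) * inner (x (Suc m)) v + (\<alpha> - 1) / 2 * (norm D)\<^sup>2 + (\<alpha> / 2 - 1) * inner D v
      \<le> \<alpha> * (N + (norm \<delta>)\<^sup>2)"
  proof -
    have "- inner (x (Suc m)) v \<le> ((norm \<delta>)\<^sup>2 + (norm v)\<^sup>2) / 2"
      using x_g_ge[of "Suc m"] m sum_squares_bound[of "norm \<delta>" "norm v"]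
      by (simp add: \<delta>_def v_def)
    moreover have "inner D v \<le> ((norm D)\<^sup>2 + (norm v)\<^sup>2) / 2"
      using Cauchy_Schwarz_ineq2[of D v] sum_squares_bound[of "norm D" "norm v"] by simp
    ultimately have "(\<alpha> / 2 - 1) * (- inner (x (Suc m)) v + inner D v)
        \<le> (\<alpha> / 2 - 1) * (((norm \<delta>)\<^sup>2 + (norm v)\<^sup>2) / 2 + ((norm D)\<^sup>2 + (norm v)\<^sup>2) / 2)"
      using b by (intro mult_left_mono add_mono)
    also have "\<dots> \<le> \<alpha> / 2 * (N + (norm \<delta>)\<^sup>2)"
    proof (rule mult_mono)
      show "((norm \<delta>)\<^sup>2 + (norm v)\<^sup>2) / 2 + ((norm D)\<^sup>2 + (norm v)\<^sup>2) / 2 \<le> N + (norm \<delta>)\<^sup>2"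
        using zero_le_power2[of "norm \<delta>"] zero_le_power2[of "norm D"]
        unfolding N_def add_divide_distrib by linarith
    qed (use \<alpha>_gt in auto)
    finally have "(\<alpha> / 2 - 1) * (- inner (x (Suc m)) v + inner D v) \<le> \<alpha> / 2 * (N + (norm \<delta>)\<^sup>2)" .
    moreover have "(\<alpha> - 1) / 2 * (norm D)\<^sup>2 \<le> \<alpha> / 2 * (N + (norm \<delta>)\<^sup>2)"
      unfolding N_def using \<alpha>_gt by (intro mult_mono) auto
    ultimately show ?thesis by (simp add: field_simps)
  qed
  then have rest: "\<mu> * (- (\<alpha> / 2 - 1) * inner (x (Suc m)) v + (\<alpha> - 1) / 2 * (norm D)\<^sup>2 + (\<alpha> / 2 - 1) * inner D v)
      \<le> \<mu> * (\<alpha> * (N + (norm \<delta>)\<^sup>2))"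
    using \<mu> by (intro mult_left_mono) auto
  have form: "(real m + 1) * (\<rho> * N) \<le> (real m + 1) *
      ((\<alpha> - 1 - \<mu>) * ((norm D)\<^sup>2 + inner D v) + (\<alpha> / 2 - 1) / 2 * (norm v)\<^sup>2)"
    using cross_form_dissipative[OF \<mu>, of D v] unfolding \<rho>_def N_def by (intro mult_left_mono) auto
  define P where "P = (norm D)\<^sup>2 + inner D v"
  have "anchor (Suc m) - anchor m = (real m + 1) * P
      + (- (\<alpha> / 2 - 1) * inner (x (Suc m)) v + (\<alpha> - 1) / 2 * (norm D)\<^sup>2 + (\<alpha> / 2 - 1) * inner D v)"
    unfolding anchor_step P_def by (simp add: algebra_simps)
  then have "\<mu> * (anchor (Suc m) - anchor m) \<le> (real m + 1) * (\<mu> * P) + \<mu> * (\<alpha> * (N + (norm \<delta>)\<^sup>2))"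
    using rest by (simp only: distrib_left mult.left_commute)
  moreover have "(real m + 1) * ((\<alpha> - 1) * P + (\<alpha> / 2 - 1) / 2 * (norm v)\<^sup>2)
      = (real m + 1) * (\<mu> * P) + (real m + 1) * ((\<alpha> - 1 - \<mu>) * P + (\<alpha> / 2 - 1) / 2 * (norm v)\<^sup>2)"
    by (simp add: algebra_simps)
  moreover have "energy \<mu> (Suc m) - energy \<mu> m = \<mu> * (anchor (Suc m) - anchor m) + (kin (Suc m) - kin m)"
    unfolding energy_def by (simp add: algebra_simps)
  ultimately have "energy \<mu> (Suc m) - energy \<mu> m \<le> - (real m + 1) * (\<rho> * N)
      + \<alpha>\<^sup>2 / (8 * \<beta>) * N + \<mu> * (\<alpha> * (N + (norm \<delta>)\<^sup>2)) - (\<beta> * (real m)\<^sup>2 - real m / 2) * (norm \<delta>)\<^sup>2"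
    using kin_step form unfolding P_def[symmetric] by linarith
  also have "\<dots> \<le> - (\<rho> * (real m + 1) - K) * N - (\<beta> * (real m)\<^sup>2 - real m / 2 - K) * (norm \<delta>)\<^sup>2"
  proof -
    have "0 \<le> \<alpha>\<^sup>2 / (8 * \<beta>) * (norm \<delta>)\<^sup>2" using \<beta>_pos by simp
    moreover have "K * N = \<alpha>\<^sup>2 / (8 * \<beta>) * N + \<mu> * (\<alpha> * N)"
      and "K * (norm \<delta>)\<^sup>2 = \<alpha>\<^sup>2 / (8 * \<beta>) * (norm \<delta>)\<^sup>2 + \<mu> * (\<alpha> * (norm \<delta>)\<^sup>2)"
      unfolding K_def by (simp_all only: distrib_right mult.assoc)
    moreover have "(\<rho> * (real m + 1) - K) * N = (real m + 1) * (\<rho> * N) - K * N"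
      and "(\<beta> * (real m)\<^sup>2 - real m / 2 - K) * (norm \<delta>)\<^sup>2
        = (\<beta> * (real m)\<^sup>2 - real m / 2) * (norm \<delta>)\<^sup>2 - K * (norm \<delta>)\<^sup>2"
      and "\<mu> * (\<alpha> * (N + (norm \<delta>)\<^sup>2)) = \<mu> * (\<alpha> * N) + \<mu> * (\<alpha> * (norm \<delta>)\<^sup>2)"
      by (simp_all add: algebra_simps)
    ultimately show ?thesis by linarith
  qed
  finally show ?thesis unfolding N_def D_def v_def \<delta>_def .
qed

text \<open>
  For large \<open>n\<close> both brackets in \<open>energy_step\<close> exceed \<open>\<rho> (n + 1) / 2\<close>.
\<close>

lemma energy_dissipation:
  assumes \<mu>: "1 < \<mu>" "\<mu> < \<alpha> - 1"
  shows "\<exists>\<epsilon>>0. \<forall>\<^sub>F n in sequentially.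
    \<epsilon> * (real (Suc n) * size_sq (Suc n)) \<le> energy \<mu> n - energy \<mu> (Suc n)"
proof -
  define \<rho> where "\<rho> = min ((\<alpha> - 1 - \<mu>) / 2) ((\<mu> - 1) / 6)"
  define K where "K = \<alpha>\<^sup>2 / (8 * \<beta>) + \<mu> * \<alpha>"
  have \<rho>: "\<rho> > 0" using \<mu> by (simp add: \<rho>_def)
  have "\<forall>\<^sub>F n in sequentially. \<rho> / 2 * (real n + 1) \<le> \<rho> * (real n + 1) - K"
    using \<rho> by real_asymp
  moreover have "\<forall>\<^sub>F n in sequentially. \<rho> / 2 * (real n + 1) \<le> \<beta> * (real n)\<^sup>2 - real n / 2 - K"
    using \<beta>_pos by real_asymp
  ultimately have "\<forall>\<^sub>F n in sequentially.
      \<rho> / 2 * (real (Suc n) * size_sq (Suc n)) \<le> energy \<mu> n - energy \<mu> (Suc n)"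
    using eventually_ge_at_top[of 2]
  proof eventually_elim
    case (elim n)
    define N where "N = (norm (d (Suc n)))\<^sup>2 + (norm (g (Suc n)))\<^sup>2"
    have "\<rho> / 2 * (real n + 1) * N \<le> (\<rho> * (real n + 1) - K) * N"
      using elim(1) by (rule mult_right_mono) (simp add: N_def)
    moreover have "\<rho> / 2 * (real n + 1) * (norm (dg (Suc n)))\<^sup>2
        \<le> (\<beta> * (real n)\<^sup>2 - real n / 2 - K) * (norm (dg (Suc n)))\<^sup>2"
      using elim(2) by (rule mult_right_mono) simp
    moreover have "\<rho> / 2 * (real (Suc n) * size_sq (Suc n))
        = \<rho> / 2 * (real n + 1) * N + \<rho> / 2 * (real n + 1) * (norm (dg (Suc n)))\<^sup>2"
      unfolding size_sq_def N_def by (simp add: field_simps)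
    ultimately show ?case
      using energy_step[OF \<mu> elim(3)] unfolding \<rho>_def K_def N_def by linarith
  qed
  with \<rho> show ?thesis by (intro exI[of _ "\<rho> / 2"]) auto
qed

lemma energy_eventually_decreasing:
  assumes "1 < \<mu>" "\<mu> < \<alpha> - 1"
  shows "\<forall>\<^sub>F n in sequentially. energy \<mu> (Suc n) \<le> energy \<mu> n"
proof -
  obtain \<epsilon> where "\<epsilon> > 0" and diss: "\<forall>\<^sub>F n in sequentially.
      \<epsilon> * (real (Suc n) * size_sq (Suc n)) \<le> energy \<mu> n - energy \<mu> (Suc n)"
    using energy_dissipation[OF assms] by blast
  from diss show ?thesis
  proof eventually_elim
    case (elim n)
    have "0 \<le> \<epsilon> * (real (Suc n) * size_sq (Suc n))"
      using \<open>\<epsilon> > 0\<close> size_sq_nonneg by simp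
    with elim show ?case by linarith
  qed
qed

text \<open>
  The energy is not visibly nonnegative for every admissible \<open>\<mu>\<close>, so boundedness of the iterates
  cannot be read off from a square in it. Instead, \<open>energy \<mu> n \<le> C\<close> and \<open>kin n \<ge> 0\<close> bound the
  anchor from above. Since \<open>2 \<langle>x\<^sub>n, d\<^sub>n\<rangle> \<ge> \<bar>x\<^sub>n\<bar>\<^sup>2 - \<bar>x\<^sub>n\<^sub>-\<^sub>1\<bar>\<^sup>2\<close>, that upper bound is a damped first-order
  recursion for \<open>\<bar>x\<^sub>n\<bar>\<^sup>2\<close>; the possibly negative part of \<open>n \<langle>x\<^sub>n, g\<^sub>n\<rangle>\<close> is of size \<open>n * size_sq n\<close> and
  hence eventually absorbed by \<open>kin n\<close>.
\<close>

lemma x_bounded: "\<exists>M. \<forall>\<^sub>F n in sequentially. norm (x n) \<le> M"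
proof -
  define \<mu> where "\<mu> = \<alpha> / 2"
  have \<mu>: "1 < \<mu>" "\<mu> < \<alpha> - 1" using \<alpha>_gt by (simp_all add: \<mu>_def)
  obtain N where N: "\<And>n. n \<ge> N \<Longrightarrow> energy \<mu> (Suc n) \<le> energy \<mu> n"
    using energy_eventually_decreasing[OF \<mu>] by (auto simp: eventually_sequentially)
  have le: "energy \<mu> n \<le> energy \<mu> N" if "n \<ge> N" for n
    using that by (induction rule: dec_induct) (use N order_trans in blast)+
  have "\<forall>\<^sub>F n in sequentially. \<mu> * (real n + 1) \<le> \<beta> * (real n + 1)\<^sup>2"
    using \<beta>_pos by real_asymp
  then have "\<forall>\<^sub>F n in sequentially. (real (Suc n) + (\<alpha> - 1)) * (norm (x (Suc n)))\<^sup>2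
      \<le> real (Suc n) * (norm (x n))\<^sup>2 + 2 * energy \<mu> N / \<mu>"
    using eventually_ge_at_top[of "max N 1"]
  proof eventually_elim
    case (elim n)
    let ?m = "Suc n"
    have m: "?m \<ge> 2" "?m \<ge> N" using elim(2) by auto
    have "norm (dg ?m) * norm (g ?m) \<le> size_sq ?m"
      using sum_squares_bound[of "norm (dg ?m)" "norm (g ?m)"]
        zero_le_power2[of "norm (d ?m)"] zero_le_power2[of "norm (g ?m)"] zero_le_power2[of "norm (dg ?m)"]
      unfolding size_sq_def by linarith
    with x_g_ge[OF m(1)] have "- size_sq ?m \<le> inner (x ?m) (g ?m)" by linarith
    then have "\<mu> * real ?m * (- size_sq ?m) \<le> \<mu> * real ?m * inner (x ?m) (g ?m)"
      using \<mu> by (intro mult_left_mono) auto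
    moreover have "\<mu> * real ?m * size_sq ?m \<le> kin ?m"
    proof -
      have "\<mu> * real ?m * size_sq ?m \<le> \<beta> * (real ?m)\<^sup>2 * size_sq ?m"
        using elim(1) size_sq_nonneg by (intro mult_right_mono) (auto simp: add.commute)
      then show ?thesis using kin_bounds(1)[OF m(1)] by (simp add: mult.assoc)
    qed
    ultimately have "0 \<le> \<mu> * real ?m * inner (x ?m) (g ?m) + kin ?m" by simp
    moreover have "energy \<mu> ?m = \<mu> * ((\<alpha> - 1) / 2 * (norm (x ?m))\<^sup>2 + real ?m * inner (x ?m) (d ?m))
        + (\<mu> * real ?m * inner (x ?m) (g ?m) + kin ?m)"
      unfolding energy_def anchor_def by (simp add: inner_simps algebra_simps)
    ultimately have "\<mu> * ((\<alpha> - 1) / 2 * (norm (x ?m))\<^sup>2 + real ?m * inner (x ?m) (d ?m)) \<le> energy \<mu> N"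
      using le[OF m(2)] by linarith
    then have 1: "(\<alpha> - 1) / 2 * (norm (x ?m))\<^sup>2 + real ?m * inner (x ?m) (d ?m) \<le> energy \<mu> N / \<mu>"
      using \<mu> by (simp add: field_simps)
    have "x n = x ?m - d ?m" by (simp add: x_def d_def)
    then have "2 * inner (x ?m) (d ?m) = (norm (x ?m))\<^sup>2 - (norm (x n))\<^sup>2 + (norm (d ?m))\<^sup>2"
      by (simp add: power2_norm_eq_inner inner_simps inner_commute)
    then have "(norm (x ?m))\<^sup>2 - (norm (x n))\<^sup>2 \<le> 2 * inner (x ?m) (d ?m)" by simp
    then have "real ?m * ((norm (x ?m))\<^sup>2 - (norm (x n))\<^sup>2) \<le> real ?m * (2 * inner (x ?m) (d ?m))"
      by (rule mult_left_mono) simp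
    moreover have "2 * ((\<alpha> - 1) / 2 * (norm (x ?m))\<^sup>2 + real ?m * inner (x ?m) (d ?m))
        = (\<alpha> - 1) * (norm (x ?m))\<^sup>2 + real ?m * (2 * inner (x ?m) (d ?m))"
      by (simp add: distrib_left)
    moreover have "2 * energy \<mu> N / \<mu> = 2 * (energy \<mu> N / \<mu>)" by simp
    ultimately show ?case
      using 1 unfolding right_diff_distrib distrib_right by linarith
  qed
  from damped_recursion_bounded[OF _ this] obtain M
    where "\<forall>\<^sub>F n in sequentially. (norm (x n))\<^sup>2 \<le> M"
    using \<alpha>_gt by auto
  then have "\<forall>\<^sub>F n in sequentially. norm (x n) \<le> sqrt M"
    by eventually_elim (simp add: real_le_rsqrt)
  then show ?thesis by blast
qed

text \<open>
  With the iterates bounded, \<open>\<mu> * anchor n\<close> is bounded below by a term linear in \<open>n (\<bar>d n\<bar> + \<bar>g n\<bar>)\<close>,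
  whereas \<open>kin n\<close> is at least quadratic in it; so the decreasing energy is bounded below.
\<close>

lemma energy_convergent:
  assumes \<mu>: "1 < \<mu>" "\<mu> < \<alpha> - 1"
  shows "convergent (energy \<mu>)"
proof -
  obtain M where M: "\<forall>\<^sub>F n in sequentially. norm (x n) \<le> M" using x_bounded by blast
  have "\<forall>\<^sub>F n in sequentially. - (\<mu> * M)\<^sup>2 / (2 * \<beta>) \<le> energy \<mu> n"
    using M eventually_ge_at_top[of 2]
  proof eventually_elim
    case (elim n)
    have bound: "\<mu> * real n * (- inner (x n) y) \<le> \<beta> * ((real n)\<^sup>2 * (norm y)\<^sup>2) + (\<mu> * M)\<^sup>2 / (4 * \<beta>)" for y
    proof -
      have "- inner (x n) y \<le> norm (x n) * norm y"
        using Cauchy_Schwarz_ineq2[of "x n" y] by simp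
      also have "\<dots> \<le> M * norm y" using elim(1) by (intro mult_right_mono) auto
      finally have "\<mu> * real n * (- inner (x n) y) \<le> \<mu> * real n * (M * norm y)"
        using \<mu> by (intro mult_left_mono) auto
      also have "\<dots> = (real n * norm y) * (\<mu> * M)" by simp
      also have "\<dots> \<le> \<beta> * (real n * norm y)\<^sup>2 + (\<mu> * M)\<^sup>2 / (4 * \<beta>)"
        by (rule weighted_young[OF \<beta>_pos])
      finally show ?thesis by (simp add: power_mult_distrib)
    qed
    have "\<beta> * ((real n)\<^sup>2 * (norm (d n))\<^sup>2) + \<beta> * ((real n)\<^sup>2 * (norm (g n))\<^sup>2) \<le> kin n"
    proof -
      have "0 \<le> \<beta> * ((real n)\<^sup>2 * (norm (dg n))\<^sup>2)" using \<beta>_pos by simp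
      then show ?thesis using kin_bounds(1)[OF elim(2)] unfolding size_sq_def distrib_left by linarith
    qed
    moreover have "0 \<le> \<mu> * ((\<alpha> - 1) / 2 * (norm (x n))\<^sup>2)" using \<mu> \<alpha>_gt by simp
    moreover have "energy \<mu> n = \<mu> * ((\<alpha> - 1) / 2 * (norm (x n))\<^sup>2)
        - \<mu> * real n * (- inner (x n) (d n)) - \<mu> * real n * (- inner (x n) (g n)) + kin n"
      unfolding energy_def anchor_def by (simp add: inner_simps algebra_simps)
    moreover have "(\<mu> * M)\<^sup>2 / (2 * \<beta>) = (\<mu> * M)\<^sup>2 / (4 * \<beta>) + (\<mu> * M)\<^sup>2 / (4 * \<beta>)" by simp
    ultimately show ?case using bound[of "d n"] bound[of "g n"] by linarith
  qed
  with energy_eventually_decreasing[OF \<mu>] show ?thesis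
    by (rule convergent_if_eventually_decseq_bounded_below)
qed

lemma summable_size: "summable (\<lambda>n. real n * size_sq n)"
proof -
  have \<mu>: "1 < \<alpha> / 2" "\<alpha> / 2 < \<alpha> - 1" using \<alpha>_gt by simp_all
  obtain \<epsilon> where "\<epsilon> > 0" and "\<forall>\<^sub>F n in sequentially.
      \<epsilon> * (real (Suc n) * size_sq (Suc n)) \<le> energy (\<alpha> / 2) n - energy (\<alpha> / 2) (Suc n)"
    using energy_dissipation[OF \<mu>] by blast
  then have "summable (\<lambda>n. \<epsilon> * (real (Suc n) * size_sq (Suc n)))"
    using size_sq_nonneg energy_convergent[OF \<mu>]
    by (intro summable_if_eventually_telescoping) auto
  then have "summable (\<lambda>n. real (Suc n) * size_sq (Suc n))"
    using \<open>\<epsilon> > 0\<close> by (subst (asm) summable_cmult_iff) auto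
  then show ?thesis by (subst (asm) summable_Suc_iff)
qed

text \<open>
  \<open>kin\<close> is a linear combination of two convergent energies, and \<open>kin n / n\<close> is summable because it
  is at most \<open>n * size_sq n\<close>. As the harmonic series diverges, the limit is \<open>0\<close>.
\<close>

lemma kin_tendsto_0: "kin \<longlonglongrightarrow> 0"
proof -
  \<comment> \<open>Any two distinct values in the interval from \<open>1\<close> to \<open>\<alpha> - 1\<close> serve; these divide it into
    three equal parts.\<close>
  define \<mu> \<nu> where "\<mu> = (\<alpha> + 1) / 3" and "\<nu> = (2 * \<alpha> - 1) / 3"
  have \<mu>: "1 < \<mu>" "\<mu> < \<alpha> - 1" and \<nu>: "1 < \<nu>" "\<nu> < \<alpha> - 1" and neq: "\<nu> \<noteq> \<mu>"
    using \<alpha>_gt by (simp_all add: \<mu>_def \<nu>_def field_simps)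
  have kin: "kin n = (\<nu> * energy \<mu> n - \<mu> * energy \<nu> n) / (\<nu> - \<mu>)" for n
    using neq by (simp add: energy_def field_simps)
  from energy_convergent[OF \<mu>] energy_convergent[OF \<nu>] obtain a b
    where "energy \<mu> \<longlonglongrightarrow> a" "energy \<nu> \<longlonglongrightarrow> b" by (auto simp: convergent_def)
  then have "kin \<longlonglongrightarrow> (\<nu> * a - \<mu> * b) / (\<nu> - \<mu>)"
    unfolding kin using neq by (intro tendsto_intros) auto
  then obtain l where l: "(\<lambda>n. kin (n + 2)) \<longlonglongrightarrow> l" by (blast intro: LIMSEQ_ignore_initial_segment)
  have nonneg: "0 \<le> kin (n + 2)" for n
    using kin_bounds(1)[of "n + 2"] \<beta>_pos size_sq_nonneg[of "n + 2"]
    by (smt (verit) le_add2 mult_nonneg_nonneg zero_le_power2)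
  \<comment> \<open>The index shift by \<open>2\<close> reaches the range of \<open>kin_bounds\<close>; it costs the factor \<open>(n + 2) / n \<le> 3\<close>.\<close>
  have "summable (\<lambda>n. 3 * (real (n + 2) * size_sq (n + 2)))"
    using summable_size by (intro summable_mult) (subst summable_iff_shift)
  then have "summable (\<lambda>n. kin (n + 2) / real n)"
  proof (rule summable_comparison_test_ev[rotated])
    show "\<forall>\<^sub>F n in sequentially. norm (kin (n + 2) / real n) \<le> 3 * (real (n + 2) * size_sq (n + 2))"
      using eventually_ge_at_top[of 1]
    proof eventually_elim
      case (elim n)
      have "kin (n + 2) \<le> real (n + 2) * (real (n + 2) * size_sq (n + 2))"
        using kin_bounds(2)[of "n + 2"] by (simp add: power2_eq_square)
      also have "\<dots> \<le> (3 * real n) * (real (n + 2) * size_sq (n + 2))"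
        using elim size_sq_nonneg by (intro mult_right_mono) auto
      finally show ?case using elim nonneg[of n] by (simp add: divide_le_eq mult_ac)
    qed
  qed
  from limit_zero_if_harmonic_summable[OF l nonneg this] l have "(\<lambda>n. kin (n + 2)) \<longlonglongrightarrow> 0"
    by (simp only:)
  then show ?thesis by (rule LIMSEQ_offset)
qed

lemma rates:
  shows "(\<lambda>n. real n * norm (d n)) \<longlonglongrightarrow> 0"
    and "(\<lambda>n. real n * norm (g n)) \<longlonglongrightarrow> 0"
    and "(\<lambda>n. real n * norm (U (z n))) \<longlonglongrightarrow> 0"
proof -
  have "(\<lambda>n. sqrt (kin n / \<beta>)) \<longlonglongrightarrow> sqrt (0 / \<beta>)"
    using \<beta>_pos by (intro tendsto_intros kin_tendsto_0) auto
  then have lim: "(\<lambda>n. sqrt (kin n / \<beta>)) \<longlonglongrightarrow> 0" by simp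
  have bound: "\<forall>\<^sub>F n in sequentially. norm (real n * norm (y n)) \<le> sqrt (kin n / \<beta>)"
    if "\<And>n. (norm (y n))\<^sup>2 \<le> size_sq n" for y :: "nat \<Rightarrow> 'a"
    using eventually_ge_at_top[of 2]
  proof eventually_elim
    case (elim n)
    have "(real n * norm (y n))\<^sup>2 \<le> (real n)\<^sup>2 * size_sq n"
      using that[of n] by (simp add: power_mult_distrib mult_left_mono)
    also have "\<dots> \<le> kin n / \<beta>"
      using kin_bounds(1)[OF elim] \<beta>_pos by (simp add: field_simps)
    finally show ?case by (simp add: real_le_rsqrt)
  qed
  show d0: "(\<lambda>n. real n * norm (d n)) \<longlonglongrightarrow> 0"
    by (rule Lim_null_comparison[OF bound lim]) (simp add: size_sq_def)
  show g0: "(\<lambda>n. real n * norm (g n)) \<longlonglongrightarrow> 0"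
    by (rule Lim_null_comparison[OF bound lim]) (simp add: size_sq_def)
  have dg0: "(\<lambda>n. real n * norm (dg n)) \<longlonglongrightarrow> 0"
    by (rule Lim_null_comparison[OF bound lim]) (simp add: size_sq_def)
  have "\<forall>\<^sub>F n in sequentially.
      norm (real n * norm (U (z n))) \<le> real n * norm (g n) + real n * norm (dg n)"
    using eventually_ge_at_top[of 2]
  proof eventually_elim
    case (elim n)
    have "norm (U (z n)) \<le> norm (g n) + norm (e n)"
      using norm_triangle_ineq4[of "g n" "e n"] by (simp add: e_def)
    also have "norm (e n) \<le> norm (dg n)"
      using e_le[OF elim] mult_right_mono[of \<kappa> 1 "norm (dg n)"] \<kappa>_less by simp
    finally show ?case by (simp add: mult_left_mono flip: distrib_left)
  qed
  then show "(\<lambda>n. real n * norm (U (z n))) \<longlonglongrightarrow> 0"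
    by (rule Lim_null_comparison) (use tendsto_add[OF g0 dg0] in simp)
qed

lemma gap_rate: "(\<lambda>n. real n * inner (x n) (U (z n))) \<longlonglongrightarrow> 0"
proof -
  obtain M where M: "\<forall>\<^sub>F n in sequentially. norm (x n) \<le> M" using x_bounded by blast
  then have "\<forall>\<^sub>F n in sequentially.
      norm (real n * inner (x n) (U (z n))) \<le> M * (real n * norm (U (z n)))"
  proof eventually_elim
    case (elim n)
    have "\<bar>inner (x n) (U (z n))\<bar> \<le> norm (x n) * norm (U (z n))"
      by (rule Cauchy_Schwarz_ineq2)
    also have "\<dots> \<le> M * norm (U (z n))" using elim by (intro mult_right_mono) auto
    finally have "real n * \<bar>inner (x n) (U (z n))\<bar> \<le> real n * (M * norm (U (z n)))"
      by (intro mult_left_mono) auto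
    then show ?case by (simp add: abs_mult mult_ac)
  qed
  then show ?thesis
    by (rule Lim_null_comparison) (use tendsto_mult_right_zero[OF rates(3)] in simp)
qed

end

section \<open>Rates of convergence\<close>

lemma smallo_inverse_nat_iff:
  fixes f :: "nat \<Rightarrow> real"
  shows "f \<in> o(\<lambda>n. 1 / real n) \<longleftrightarrow> (\<lambda>n. real n * f n) \<longlonglongrightarrow> 0"
proof -
  have "\<forall>\<^sub>F n in sequentially. 1 / real n \<noteq> 0"
    using eventually_gt_at_top[of 0] by eventually_elim simp
  then have "f \<in> o(\<lambda>n. 1 / real n) \<longleftrightarrow> (\<lambda>n. f n / (1 / real n)) \<longlonglongrightarrow> 0"
    by (metis smalloI_tendsto smalloD_tendsto)
  then show ?thesis by (simp add: mult.commute)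
qed

lemma explicit_fast_OGDA_absorb_step:
  "explicit_fast_OGDA V \<alpha> s z zb \<Longrightarrow> explicit_fast_OGDA (\<lambda>y. s *\<^sub>R V y) \<alpha> 1 z zb"
  unfolding explicit_fast_OGDA_def
  by (simp add: scaleR_diff_right[symmetric] mult_ac)

theorem theorem17:
  fixes V :: "'a::{real_inner, complete_space} \<Rightarrow> 'a"
    and L \<alpha> s :: real
    and z zb :: "nat \<Rightarrow> 'a"
    and z_star :: 'a
  assumes "monotone_operator V"
    and "L > 0"
    and "L-lipschitz_on UNIV V"
    and "\<alpha> > 2"
    and "0 < s" and "s < 1 / (2 * L)"
    and "explicit_fast_OGDA V \<alpha> s z zb"
    and "z_star \<in> zeros V"
  shows "(\<lambda>k. norm (z k - z (k - 1))) \<in> o(\<lambda>k. 1 / real k) \<and>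
         (\<lambda>k. inner (z k - z_star) (V (z k))) \<in> o(\<lambda>k. 1 / real k) \<and>
         (\<lambda>k. norm (V (z k))) \<in> o(\<lambda>k. 1 / real k) \<and>
         (\<lambda>k. norm (V (zb k))) \<in> o(\<lambda>k. 1 / real k)"
proof -
  define U where "U = (\<lambda>y. s *\<^sub>R V y)"
  interpret fast_ogda_iteration U \<alpha> "s * L" z zb z_star
  proof
    show "0 \<le> inner (u - w) (U u - U w)" for u w
      using assms(1,5) by (simp add: U_def monotone_operator_def flip: scaleR_diff_right)
    show "norm (U u - U w) \<le> s * L * norm (u - w)" for u w
      using lipschitz_onD[OF assms(3), of u w] assms(5)
      by (simp add: U_def dist_norm mult.assoc mult_left_mono flip: scaleR_diff_right)
    show "s * L < 1 / 2" using assms(2,6) by (simp add: field_simps)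
    show "explicit_fast_OGDA U \<alpha> 1 z zb"
      unfolding U_def using assms(7) by (rule explicit_fast_OGDA_absorb_step)
    show "U z_star = 0" using assms(8) by (simp add: U_def zeros_def)
  qed (use assms in auto)
  have unscale: "(\<lambda>k. real k * f k) \<longlonglongrightarrow> 0" if "(\<lambda>k. real k * (s * f k)) \<longlonglongrightarrow> 0" for f :: "nat \<Rightarrow> real"
    using tendsto_mult_right_zero[OF that, of "1 / s"] \<open>0 < s\<close> by simp
  have "(\<lambda>k. real k * norm (V (zb k))) \<longlonglongrightarrow> 0"
  proof (rule unscale, rule Lim_null_comparison)
    show "\<forall>\<^sub>F k in sequentially. norm (real k * (s * norm (V (zb k)))) \<le> real (Suc k) * norm (g (Suc k))"
      unfolding g_def using \<open>0 < s\<close> by (intro always_eventually) (simp add: U_def mult_right_mono)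
    show "(\<lambda>k. real (Suc k) * norm (g (Suc k))) \<longlonglongrightarrow> 0"
      using rates(2) by (rule LIMSEQ_Suc)
  qed
  moreover have "(\<lambda>k. real k * norm (V (z k))) \<longlonglongrightarrow> 0"
    by (rule unscale) (use rates(3) \<open>0 < s\<close> in \<open>simp add: U_def\<close>)
  moreover have "(\<lambda>k. real k * inner (z k - z_star) (V (z k))) \<longlonglongrightarrow> 0"
    by (rule unscale) (use gap_rate in \<open>simp add: U_def x_def\<close>)
  moreover have "(\<lambda>k. real k * norm (z k - z (k - 1))) \<longlonglongrightarrow> 0"
    using rates(1) by (simp add: d_def)
  ultimately show ?thesis
    unfolding smallo_inverse_nat_iff by blast
qed

end
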